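(* Let $l\ge 1$, $k\ge 2$ and $n\ge k-2$ be integers. If \[ l-1\le\binom{n-k+2}{\lfloor (n-k+2)/2\rfloor}, \] then \[ \operatorname{RT}(\mathcal{B};n,C_k,l)=\operatorname{RT}^{\sharp}(\mathcal{B};n,C_k,l)=(k-1)(l-1), \] where $C_k$ is the $k$-element chain. In particular, the same conclusion holds whenever $n\ge k+l-3$.
   Context: $B_n$ is the power set of $[n]=\{1,\dots,n\}$ ordered by inclusion; a subset $Q\subseteq B_n$ (possibly empty) is regarded as a poset with the induced order. The width $w(Q)$ is the size of a largest antichain of $Q$ (with $w(\emptyset)=0$). $C_k$ is the totally ordered set with $k$ elements. An injection $f:P\to Q$ between posets is a weak embedding if $x\le y$ in $P$ implies $f(x)\le f(y)$ in $Q$, and a strong embedding if $x\le y$ in $P$ if and only if $f(x)\le f(y)$ in $Q$. $Q$ is weakly (resp. strongly) $P$-free if there is no weak (resp. strong) embedding of $P$ into $Q$. For a poset $P$, $\operatorname{RT}(\mathcal{B};n,P,l)$ (resp. $\operatorname{RT}^{\sharp}(\mathcal{B};n,P,l)$) is the maximum of $|Q|$ over all $Q\subseteq B_n$ such that $Q$ is weakly (resp. strongly) $P$-free and $w(Q)<l$ (this is the case $t=1$ of the Boolean Ramsey–Turán number for $t$-chains, where 1-chains are the elements of $Q$). *)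

theory Defs
  imports Complex_Main
begin

text \<open>
  A poset is rendered as a set over a type of class \<open>order\<close>, with the induced order. On families
  of sets, the class order is inclusion.
\<close>

definition antichain :: "'a::order set \<Rightarrow> bool" where
  "antichain A \<longleftrightarrow> (\<forall>x\<in>A. \<forall>y\<in>A. x \<le> y \<longrightarrow> x = y)"

text \<open>The maximum is meaningful for finite \<open>Q\<close>; the empty antichain gives width \<open>0\<close> to \<open>{}\<close>.\<close>

definition width :: "'a::order set \<Rightarrow> nat" where
  "width Q = Max {card A | A. A \<subseteq> Q \<and> antichain A}"

definition weak_embedding :: "'a::order set \<Rightarrow> 'b::order set \<Rightarrow> ('a \<Rightarrow> 'b) \<Rightarrow> bool" where
  "weak_embedding P Q f \<longleftrightarrow> f ` P \<subseteq> Q \<and> inj_on f P \<and>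
     (\<forall>x\<in>P. \<forall>y\<in>P. x \<le> y \<longrightarrow> f x \<le> f y)"

definition strong_embedding :: "'a::order set \<Rightarrow> 'b::order set \<Rightarrow> ('a \<Rightarrow> 'b) \<Rightarrow> bool" where
  "strong_embedding P Q f \<longleftrightarrow> f ` P \<subseteq> Q \<and> inj_on f P \<and>
     (\<forall>x\<in>P. \<forall>y\<in>P. x \<le> y \<longleftrightarrow> f x \<le> f y)"

definition weakly_free :: "'a::order set \<Rightarrow> 'b::order set \<Rightarrow> bool" where
  "weakly_free P Q \<longleftrightarrow> (\<nexists>f. weak_embedding P Q f)"

definition strongly_free :: "'a::order set \<Rightarrow> 'b::order set \<Rightarrow> bool" where
  "strongly_free P Q \<longleftrightarrow> (\<nexists>f. strong_embedding P Q f)"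

definition boolean_lattice :: "nat \<Rightarrow> nat set set" where
  "boolean_lattice n = Pow {1..n}"

definition chain_poset :: "nat \<Rightarrow> nat set" where
  "chain_poset k = {1..k}"

text \<open>
  Boolean Ramsey--Turan numbers (for 1-chains). The sets below are finite; they contain \<open>0\<close>, via
  the empty family, whenever \<open>P\<close> is nonempty and \<open>l \<ge> 1\<close>.
\<close>

definition RT_weak :: "nat \<Rightarrow> 'a::order set \<Rightarrow> nat \<Rightarrow> nat" where
  "RT_weak n P l =
     Max {card Q | Q. Q \<subseteq> boolean_lattice n \<and> weakly_free P Q \<and> width Q < l}"

definition RT_strong :: "nat \<Rightarrow> 'a::order set \<Rightarrow> nat \<Rightarrow> nat" where
  "RT_strong n P l =
     Max {card Q | Q. Q \<subseteq> boolean_lattice n \<and> strongly_free P Q \<and> width Q < l}"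

end

theory Submission
  imports Defs
begin

text \<open>
  On a chain the two notions of freeness coincide, because an injective monotone map out of a
  totally ordered set reflects the order; so there is only one number to determine.

  The upper bound is Mirsky's theorem: peeling off the maximal elements \<open>k - 1\<close> times exhausts a
  finite poset without a \<open>k\<close>-element chain, and every layer is an antichain, hence has at most
  \<open>l - 1\<close> elements (\<open>card_le_width_if_chain_free\<close>).

  For the lower bound write \<open>n = m + (k - 2)\<close> and take \<open>l - 1\<close> sets in the middle layer of \<open>B\<^sub>m\<close>,
  which is possible exactly under the hypothesis on \<open>l\<close>. Above each such \<open>S\<close> put the chain
  \<open>S \<subset> S \<union> {m+1} \<subset> \<dots> \<subset> S \<union> {m+1, \<dots>, n}\<close> of \<open>k - 1\<close> sets. The resulting family is a disjoint union
  of \<open>l - 1\<close> chains, which bounds its width, and it occupies \<open>k - 1\<close> layers of \<open>B\<^sub>n\<close>, which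
  bounds its height; its size is \<open>(k - 1) * (l - 1)\<close>.
\<close>

section \<open>Chains in a poset\<close>

lemma weak_embedding_chain_poset_iff:
  "weak_embedding (chain_poset k) Q f \<longleftrightarrow> f ` {1..k} \<subseteq> Q \<and> strict_mono_on {1..k} f"
proof
  assume "weak_embedding (chain_poset k) Q f"
  then show "f ` {1..k} \<subseteq> Q \<and> strict_mono_on {1..k} f"
    unfolding weak_embedding_def chain_poset_def strict_mono_on_def inj_on_def
    by (metis less_le)
next
  assume "f ` {1..k} \<subseteq> Q \<and> strict_mono_on {1..k} f"
  then show "weak_embedding (chain_poset k) Q f"
    unfolding weak_embedding_def chain_poset_def
    using strict_mono_on_imp_inj_on strict_mono_on_leD by blast
qed

text \<open>
  A strictly increasing map reflects the order here because any two of its arguments are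
  comparable.
\<close>

lemma strong_embedding_chain_poset_iff:
  "strong_embedding (chain_poset k) Q f \<longleftrightarrow> weak_embedding (chain_poset k) Q f"
proof
  assume "strong_embedding (chain_poset k) Q f"
  then show "weak_embedding (chain_poset k) Q f"
    unfolding strong_embedding_def weak_embedding_def by blast
next
  assume weak: "weak_embedding (chain_poset k) Q f"
  then have mono: "strict_mono_on {1..k} f"
    by (simp add: weak_embedding_chain_poset_iff)
  have "x \<le> y" if "x \<in> {1..k}" "y \<in> {1..k}" "f x \<le> f y" for x y
    using strict_mono_onD[OF mono that(2,1)] that(3) by (meson leD leI)
  with weak show "strong_embedding (chain_poset k) Q f"
    unfolding strong_embedding_def weak_embedding_def chain_poset_def by blast
qed

lemma strongly_free_chain_poset_iff:
  "strongly_free (chain_poset k) Q \<longleftrightarrow> weakly_free (chain_poset k) Q"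
  by (simp add: strongly_free_def weakly_free_def strong_embedding_chain_poset_iff)

text \<open>
  A strictly increasing function into \<open>c\<close> consecutive integers cannot take more than \<open>c\<close>
  values along a chain, so such a function bounds the height.
\<close>

lemma weakly_free_chain_poset_if_rank:
  fixes r :: "'a::order \<Rightarrow> nat"
  assumes rank: "\<And>x y. x \<in> Q \<Longrightarrow> y \<in> Q \<Longrightarrow> x < y \<Longrightarrow> r x < r y"
    and range: "r ` Q \<subseteq> {a..<a + c}" and "c < k"
  shows "weakly_free (chain_poset k) Q"
  unfolding weakly_free_def
proof
  assume "\<exists>f. weak_embedding (chain_poset k) Q f"
  then obtain f where f: "f ` {1..k} \<subseteq> Q" "strict_mono_on {1..k} f"
    by (auto simp: weak_embedding_chain_poset_iff)
  then have "strict_mono_on {1..k} (r \<circ> f)"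
    by (auto simp: strict_mono_on_def intro!: rank)
  then have "inj_on (r \<circ> f) {1..k}"
    by (rule strict_mono_on_imp_inj_on)
  moreover have "(r \<circ> f) ` {1..k} \<subseteq> {a..<a + c}"
    using f(1) range by (auto simp: image_subset_iff)
  ultimately have "card {1..k} \<le> card {a..<a + c}"
    by (rule card_inj_on_le) simp
  with \<open>c < k\<close> show False by simp
qed

section \<open>Width and the upper bound\<close>

lemma finite_antichain_cards:
  "finite Q \<Longrightarrow> finite {card A | A. A \<subseteq> Q \<and> antichain A}"
  by simp

lemma card_le_width:
  "finite Q \<Longrightarrow> A \<subseteq> Q \<Longrightarrow> antichain A \<Longrightarrow> card A \<le> width Q"
  unfolding width_def by (rule Max_ge[OF finite_antichain_cards]) auto

lemma width_le:
  assumes "finite Q" and "\<And>A. A \<subseteq> Q \<Longrightarrow> antichain A \<Longrightarrow> card A \<le> w"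
  shows "width Q \<le> w"
proof -
  have "antichain ({} :: 'a set)"
    by (simp add: antichain_def)
  then have "{card A | A. A \<subseteq> Q \<and> antichain A} \<noteq> {}"
    by blast
  with assms show ?thesis
    unfolding width_def by (subst Max_le_iff[OF finite_antichain_cards]) auto
qed

text \<open>
  The easy half of Dilworth's theorem: the fibres of \<open>g\<close> are chains, and an
  antichain meets each of them at most once.
\<close>

lemma width_le_if_chain_fibres:
  assumes "finite Q" "finite F" "g ` Q \<subseteq> F"
    and "\<And>x y. x \<in> Q \<Longrightarrow> y \<in> Q \<Longrightarrow> g x = g y \<Longrightarrow> x \<le> y \<or> y \<le> x"
  shows "width Q \<le> card F"
proof (rule width_le[OF \<open>finite Q\<close>])
  fix A assume "A \<subseteq> Q" "antichain A"
  then have "inj_on g A"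
    using assms(4) unfolding antichain_def inj_on_def by (metis subsetD)
  moreover have "g ` A \<subseteq> F"
    using \<open>A \<subseteq> Q\<close> assms(3) by blast
  ultimately show "card A \<le> card F"
    using \<open>finite F\<close> by (rule card_inj_on_le)
qed

text \<open>
  Mirsky's theorem, by induction on the height. The maximal elements form an antichain, and
  deleting them shortens the longest chain, since a chain of non-maximal elements can be extended
  at its top.
\<close>

lemma card_le_if_chain_free:
  assumes "finite Q" and "weakly_free (chain_poset (Suc h)) Q"
    and "\<And>A. A \<subseteq> Q \<Longrightarrow> antichain A \<Longrightarrow> card A \<le> w"
  shows "card Q \<le> h * w"
  using assms
proof (induction h arbitrary: Q)
  case 0
  have "Q = {}"
  proof (rule ccontr)
    assume "Q \<noteq> {}"
    then obtain q where "q \<in> Q" by blast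
    then have "weak_embedding (chain_poset (Suc 0)) Q (\<lambda>_. q)"
      by (auto simp: weak_embedding_chain_poset_iff strict_mono_on_def)
    with 0 show False by (auto simp: weakly_free_def)
  qed
  then show ?case by simp
next
  case (Suc h)
  define M where "M = {x \<in> Q. \<forall>y\<in>Q. \<not> x < y}"
  have "M \<subseteq> Q" by (auto simp: M_def)
  have "antichain M"
    by (auto simp: antichain_def M_def less_le)
  with \<open>M \<subseteq> Q\<close> have card_M: "card M \<le> w"
    by (rule Suc.prems(3))
  have "weakly_free (chain_poset (Suc h)) (Q - M)"
    unfolding weakly_free_def
  proof
    assume "\<exists>f. weak_embedding (chain_poset (Suc h)) (Q - M) f"
    then obtain f where f: "f ` {1..Suc h} \<subseteq> Q - M" "strict_mono_on {1..Suc h} f"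
      by (auto simp: weak_embedding_chain_poset_iff)
    have "f (Suc h) \<in> Q - M"
      using f(1) by (auto simp: image_subset_iff)
    then obtain y where y: "y \<in> Q" "f (Suc h) < y"
      by (auto simp: M_def)
    define f' where "f' = f(Suc (Suc h) := y)"
    have "f' ` {1..Suc (Suc h)} \<subseteq> Q"
      using f(1) y(1) by (auto simp: f'_def image_subset_iff)
    moreover have "strict_mono_on {1..Suc (Suc h)} f'"
    proof (rule strict_mono_onI)
      fix i j :: nat
      assume ij: "i \<in> {1..Suc (Suc h)}" "j \<in> {1..Suc (Suc h)}" "i < j"
      show "f' i < f' j"
      proof (cases "j = Suc (Suc h)")
        case True
        have "f i \<le> f (Suc h)"
          using ij True by (intro strict_mono_on_leD[OF f(2)]) auto
        with y(2) True ij show ?thesis by (auto simp: f'_def)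
      next
        case False
        with ij have "f i < f j"
          by (intro strict_mono_onD[OF f(2)]) auto
        with False ij show ?thesis by (simp add: f'_def)
      qed
    qed
    ultimately have "weak_embedding (chain_poset (Suc (Suc h))) Q f'"
      by (simp add: weak_embedding_chain_poset_iff)
    with Suc.prems(2) show False by (auto simp: weakly_free_def)
  qed
  then have "card (Q - M) \<le> h * w"
    using Suc.prems by (intro Suc.IH) auto
  moreover have "card Q = card M + card (Q - M)"
    using \<open>M \<subseteq> Q\<close> Suc.prems(1) by (metis card_Diff_subset card_mono finite_subset le_add_diff_inverse)
  ultimately show ?case using card_M by simp
qed

lemma card_le_width_if_chain_free:
  assumes "finite Q" "weakly_free (chain_poset k) Q" "k \<ge> 1"
  shows "card Q \<le> (k - 1) * width Q"
  using assms by (intro card_le_if_chain_free card_le_width) auto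

section \<open>The extremal family\<close>

definition chain_tower :: "nat \<Rightarrow> nat set set \<Rightarrow> nat \<Rightarrow> nat set set" where
  "chain_tower m F c = (\<lambda>(S, j). S \<union> {m<..m + j}) ` (F \<times> {..<c})"

text \<open>
  Intersecting with \<open>{1..m}\<close> recovers the set \<open>S\<close> at the bottom of a member's chain, and the
  cardinality then recovers its position \<open>j\<close> in that chain.
\<close>

context
  fixes m d c :: nat and F :: "nat set set"
  assumes F: "F \<subseteq> {S. S \<subseteq> {1..m} \<and> card S = d}"
begin

lemma tower_base: "S \<in> F \<Longrightarrow> (S \<union> {m<..m + j}) \<inter> {1..m} = S"
  using F by auto

lemma tower_rank:
  assumes "S \<in> F" shows "card (S \<union> {m<..m + j}) = d + j"
proof -
  have "S \<subseteq> {1..m}" "card S = d"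
    using F assms by auto
  moreover from this have "finite S" "S \<inter> {m<..m + j} = {}"
    by (auto intro: finite_subset)
  ultimately show ?thesis
    by (simp add: card_Un_disjoint)
qed

lemma finite_base_family: "finite F"
  using F by (rule finite_subset) simp

lemma finite_chain_tower: "finite (chain_tower m F c)"
  unfolding chain_tower_def using finite_base_family by simp

lemma card_chain_tower: "card (chain_tower m F c) = card F * c"
proof -
  have "inj_on (\<lambda>(S, j). S \<union> {m<..m + j}) (F \<times> {..<c})"
  proof (rule inj_onI, clarify)
    fix S i T j
    assume ST: "S \<in> F" "T \<in> F" and eq: "S \<union> {m<..m + i} = T \<union> {m<..m + j}"
    have "S = T"
      using tower_base[OF ST(1), of i] unfolding eq tower_base[OF ST(2), of j] by (rule sym)
    moreover have "d + i = d + j"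
      using tower_rank[OF ST(1), of i] unfolding eq tower_rank[OF ST(2), of j] by (rule sym)
    ultimately show "S = T \<and> i = j"
      by simp
  qed
  then show ?thesis
    unfolding chain_tower_def by (simp add: card_image card_cartesian_product)
qed

lemma chain_tower_chain_free:
  assumes "c < k" shows "weakly_free (chain_poset k) (chain_tower m F c)"
proof (rule weakly_free_chain_poset_if_rank[where r = card and a = d and c = c])
  fix x y assume "y \<in> chain_tower m F c" "x < y"
  moreover from this have "finite y"
    using F by (auto simp: chain_tower_def intro: finite_subset)
  ultimately show "card x < card y"
    by (simp add: psubset_card_mono)
next
  show "card ` chain_tower m F c \<subseteq> {d..<d + c}"
    by (auto simp: chain_tower_def tower_rank)
qed (fact assms)

lemma width_chain_tower: "width (chain_tower m F c) \<le> card F"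
proof (rule width_le_if_chain_fibres[where g = "\<lambda>x. x \<inter> {1..m}"])
  show "(\<lambda>x. x \<inter> {1..m}) ` chain_tower m F c \<subseteq> F"
  proof (rule image_subsetI)
    fix x assume "x \<in> chain_tower m F c"
    then obtain S j where "S \<in> F" "x = S \<union> {m<..m + j}"
      by (auto simp: chain_tower_def)
    then show "x \<inter> {1..m} \<in> F"
      by (simp only: tower_base)
  qed
next
  fix x y assume "x \<in> chain_tower m F c" "y \<in> chain_tower m F c"
    and eq: "x \<inter> {1..m} = y \<inter> {1..m}"
  then obtain S i T j where "S \<in> F" "T \<in> F"
    and x: "x = S \<union> {m<..m + i}" and y: "y = T \<union> {m<..m + j}"
    by (auto simp: chain_tower_def)
  with eq have "S = T"
    using tower_base[of S i] tower_base[of T j] by (simp only:)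
  with x y show "x \<le> y \<or> y \<le> x"
    by (cases "i \<le> j") auto
qed (fact finite_chain_tower finite_base_family)+

lemma chain_tower_subset:
  "m + c \<le> Suc n \<Longrightarrow> chain_tower m F c \<subseteq> boolean_lattice n"
  using F by (force simp: chain_tower_def boolean_lattice_def subset_iff)

end

section \<open>The Ramsey--Turan number of a chain\<close>

lemma RT_strong_chain_poset_eq_RT_weak:
  "RT_strong n (chain_poset k) l = RT_weak n (chain_poset k) l"
  by (simp add: RT_strong_def RT_weak_def strongly_free_chain_poset_iff)

lemma RT_weak_chain_poset:
  assumes "l \<ge> 1" "k \<ge> 2" "n \<ge> k - 2"
    and l: "l - 1 \<le> (n + 2 - k) choose ((n + 2 - k) div 2)"
  shows "RT_weak n (chain_poset k) l = (k - 1) * (l - 1)"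
  unfolding RT_weak_def
proof (rule Max_eqI)
  have "finite (boolean_lattice n)"
    by (simp add: boolean_lattice_def)
  then show "finite {card Q | Q. Q \<subseteq> boolean_lattice n \<and>
      weakly_free (chain_poset k) Q \<and> width Q < l}"
    by simp
  fix q assume "q \<in> {card Q | Q. Q \<subseteq> boolean_lattice n \<and>
      weakly_free (chain_poset k) Q \<and> width Q < l}"
  then obtain Q where Q: "q = card Q" "Q \<subseteq> boolean_lattice n"
      "weakly_free (chain_poset k) Q" "width Q < l"
    by blast
  have "card Q \<le> (k - 1) * width Q"
    using Q \<open>finite (boolean_lattice n)\<close> \<open>k \<ge> 2\<close>
    by (intro card_le_width_if_chain_free) (auto intro: finite_subset)
  also have "\<dots> \<le> (k - 1) * (l - 1)"
    using Q(4) by (intro mult_left_mono) auto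
  finally show "q \<le> (k - 1) * (l - 1)"
    using Q(1) by simp
next
  define m where "m = n + 2 - k"
  let ?L = "{S. S \<subseteq> {1..m} \<and> card S = m div 2}"
  have "card ?L = m choose (m div 2)"
    using n_subsets[of "{1..m}" "m div 2"] by simp
  with l have "l - 1 \<le> card ?L"
    by (simp add: m_def)
  then obtain F where F: "F \<subseteq> ?L" and card_F: "card F = l - 1"
    by (rule obtain_subset_with_card_n)
  let ?Q = "chain_tower m F (k - 1)"
  have "?Q \<subseteq> boolean_lattice n"
    using assms(2,3) by (intro chain_tower_subset[OF F]) (simp add: m_def)
  moreover have "weakly_free (chain_poset k) ?Q"
    using \<open>k \<ge> 2\<close> by (intro chain_tower_chain_free[OF F]) simp
  moreover have "width ?Q < l"
    using width_chain_tower[OF F, of "k - 1"] card_F \<open>l \<ge> 1\<close> by simp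
  moreover have "card ?Q = (k - 1) * (l - 1)"
    by (simp add: card_chain_tower[OF F] card_F)
  ultimately show "(k - 1) * (l - 1) \<in> {card Q | Q. Q \<subseteq> boolean_lattice n \<and>
      weakly_free (chain_poset k) Q \<and> width Q < l}"
    by (intro CollectI exI[of _ ?Q]) simp
qed

lemma le_central_binomial: "m \<le> m choose (m div 2)"
  using binomial_maximum[of m 1] by simp

theorem theorem3p5:
  fixes l k n :: nat
  assumes "l \<ge> 1" and "k \<ge> 2" and "n \<ge> k - 2"
  shows "(l - 1 \<le> (n + 2 - k) choose ((n + 2 - k) div 2) \<longrightarrow>
            RT_weak n (chain_poset k) l = (k - 1) * (l - 1) \<and>
            RT_strong n (chain_poset k) l = (k - 1) * (l - 1)) \<and>
         (n \<ge> k + l - 3 \<longrightarrow>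
            RT_weak n (chain_poset k) l = (k - 1) * (l - 1) \<and>
            RT_strong n (chain_poset k) l = (k - 1) * (l - 1))"
proof -
  have main: "RT_weak n (chain_poset k) l = (k - 1) * (l - 1) \<and>
      RT_strong n (chain_poset k) l = (k - 1) * (l - 1)"
    if "l - 1 \<le> (n + 2 - k) choose ((n + 2 - k) div 2)"
    using RT_weak_chain_poset[OF assms that] by (simp add: RT_strong_chain_poset_eq_RT_weak)
  have "l - 1 \<le> (n + 2 - k) choose ((n + 2 - k) div 2)" if "n \<ge> k + l - 3"
  proof -
    have "l - 1 \<le> n + 2 - k"
      using that assms by linarith
    also have "\<dots> \<le> (n + 2 - k) choose ((n + 2 - k) div 2)"
      by (rule le_central_binomial)
    finally show ?thesis .
  qed
  with main show ?thesis by blast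
qed

end
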